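(* Let $X_1\subset\mathbb{R}^{k_1}$, $X_2\subset\mathbb{R}^{k_2}$ be nonempty convex strategy sets, let $A\in\mathbb{R}^{k_1\times k_2}$, and consider the zero-sum game with $u_1(x_1,x_2)=x_1^\top Ax_2$ and $u_2=-u_1$ (that is, $b_1=b_2=\vec 0$). Suppose a Nash equilibrium $x^\star\in X_1\times X_2$ exists. For $i=1,2$ let $h_i:X_i\to\mathbb{R}$ be strictly convex, and suppose that the convex conjugate $h_i^*(y_i)=\max_{x_i\in X_i}\{\langle x_i,y_i\rangle-h_i(x_i)\}$ is non-negative and has compact level sets. Fix $y(0)=(y_1(0),y_2(0))$. Then the continuous-time FTRL dynamics with learning rate $\eta>0$ started at $y(0)$ satisfy $$\left\lVert\frac1T\int_0^T A x_2(t)\,dt\right\rVert\in O\!\left(\frac{1}{\eta T}\right),$$ i.e. there is a constant $C$, independent of $\eta$ and $T$, such that the left-hand side is at most $C/(\eta T)$ for all $\eta>0$, $T>0$.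
   Context: A pair $(x_1^\star,x_2^\star)\in X_1\times X_2$ is a Nash equilibrium if $u_1(x_1,x_2^\star)\le u_1(x_1^\star,x_2^\star)\le u_1(x_1^\star,x_2)$ for all $x_1\in X_1$, $x_2\in X_2$. The continuous-time Follow-the-Regularized-Leader (FTRL) dynamics with learning rate $\eta>0$ are trajectories $y_i(t)\in\mathbb{R}^{k_i}$, $x_i(t)\in X_i$, $t\ge 0$, $i=1,2$, satisfying $$y_i(t)=y_i(0)+\int_0^t\eta\,\nabla_{x_i}u_i(x(s))\,ds,\qquad x_i(t)=\arg\max_{x_i\in X_i}\{\langle x_i,y_i(t)\rangle-h_i(x_i)\},$$ where $x(t)=(x_1(t),x_2(t))$. Here $\nabla_{x_1}u_1(x)=Ax_2$ and $\nabla_{x_2}u_2(x)=-A^\top x_1$. The maximum defining $h_i^*(y_i)$ is assumed to be attained for every $y_i\in\mathbb{R}^{k_i}$. "Compact level sets" means that $\{y_i\in\mathbb{R}^{k_i}:h_i^*(y_i)\le r\}$ is compact for every $r\in\mathbb{R}$. $\lVert\cdot\rVert$ is the Euclidean norm. *)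

theory Defs
  imports "HOL-Analysis.Analysis"
begin

definition strictly_convex_on :: "'a::real_vector set \<Rightarrow> ('a \<Rightarrow> real) \<Rightarrow> bool" where
  "strictly_convex_on S f \<longleftrightarrow> convex S \<and>
    (\<forall>x\<in>S. \<forall>y\<in>S. \<forall>u>0. \<forall>v>0. x \<noteq> y \<longrightarrow> u + v = 1 \<longrightarrow>
      f (u *\<^sub>R x + v *\<^sub>R y) < u * f x + v * f y)"

(* The supremum is only the conjugate max_{x in X} (<x,y> - h x) when it is attained, which
   conjugate_attained states separately; for an unbounded objective Sup is an arbitrary real. *)
definition convex_conjugate :: "'a::real_inner set \<Rightarrow> ('a \<Rightarrow> real) \<Rightarrow> 'a \<Rightarrow> real" where
  "convex_conjugate X h y = (SUP x\<in>X. x \<bullet> y - h x)"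

definition conjugate_attained :: "'a::real_inner set \<Rightarrow> ('a \<Rightarrow> real) \<Rightarrow> bool" where
  "conjugate_attained X h \<longleftrightarrow> (\<forall>y. \<exists>x. is_arg_max (\<lambda>x. x \<bullet> y - h x) (\<lambda>x. x \<in> X) x)"

definition compact_level_sets :: "('a::topological_space \<Rightarrow> real) \<Rightarrow> bool" where
  "compact_level_sets f \<longleftrightarrow> (\<forall>r. compact {y. f y \<le> r})"

definition bilinear_payoff :: "real^'n^'m \<Rightarrow> real^'m \<Rightarrow> real^'n \<Rightarrow> real" where
  "bilinear_payoff A x1 x2 = x1 \<bullet> (A *v x2)"

(* Zero-sum form: the second inequality is player 2's condition for the utility -u1. *)
definition nash_equilibrium ::
    "'a set \<Rightarrow> 'b set \<Rightarrow> ('a \<Rightarrow> 'b \<Rightarrow> real) \<Rightarrow> 'a \<Rightarrow> 'b \<Rightarrow> bool" where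
  "nash_equilibrium X1 X2 u1 xs1 xs2 \<longleftrightarrow> xs1 \<in> X1 \<and> xs2 \<in> X2 \<and>
    (\<forall>x1\<in>X1. \<forall>x2\<in>X2. u1 x1 xs2 \<le> u1 xs1 xs2 \<and> u1 xs1 xs2 \<le> u1 xs1 x2)"

definition gradient :: "('a::real_inner \<Rightarrow> real) \<Rightarrow> 'a \<Rightarrow> 'a" where
  "gradient f x = (THE D. GDERIV f x :> D)"

lemma gradient_eqI:
  assumes "GDERIV f x :> D"
  shows "gradient f x = D"
  unfolding gradient_def
proof (rule the_equality)
  show "GDERIV f x :> D" by (rule assms)
next
  fix D' assume "GDERIV f x :> D'"
  then have "(\<lambda>h. h \<bullet> D') = (\<lambda>h. h \<bullet> D)"
    using assms unfolding gderiv_def by (rule has_derivative_unique)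
  then have "\<forall>h. h \<bullet> D' = h \<bullet> D" by metis
  then show "D' = D" by (simp add: vector_eq_ldot)
qed

lemma gradient_bilinear_payoff_left:
  "gradient (\<lambda>z. bilinear_payoff A z x2) x1 = A *v x2"
  by (rule gradient_eqI)
     (auto simp: gderiv_def bilinear_payoff_def intro!: derivative_eq_intros)

lemma gradient_bilinear_payoff_right:
  "gradient (\<lambda>z. - bilinear_payoff A x1 z) x2 = - (transpose A *v x1)"
proof (rule gradient_eqI)
  have "bilinear_payoff A x1 z = z \<bullet> (transpose A *v x1)" for z
    by (simp add: bilinear_payoff_def inner_commute flip: dot_lmul_matrix)
  then show "GDERIV (\<lambda>z. - bilinear_payoff A x1 z) x2 :> - (transpose A *v x1)"
    by (auto simp: gderiv_def intro!: derivative_eq_intros)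
qed

(* Trajectories live on [0, \<infinity>); values at negative times are unconstrained. The has_integral
   conditions include integrability of the utility gradients along the trajectory. *)
definition ftrl_dynamics ::
    "'a::euclidean_space set \<Rightarrow> 'b::euclidean_space set \<Rightarrow> ('a \<Rightarrow> real) \<Rightarrow> ('b \<Rightarrow> real) \<Rightarrow>
     ('a \<Rightarrow> 'b \<Rightarrow> real) \<Rightarrow> ('a \<Rightarrow> 'b \<Rightarrow> real) \<Rightarrow> real \<Rightarrow>
     (real \<Rightarrow> 'a) \<Rightarrow> (real \<Rightarrow> 'b) \<Rightarrow> (real \<Rightarrow> 'a) \<Rightarrow> (real \<Rightarrow> 'b) \<Rightarrow> bool" where
  "ftrl_dynamics X1 X2 h1 h2 u1 u2 \<eta> y1 y2 x1 x2 \<longleftrightarrow>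
    (\<forall>t\<ge>0.
      ((\<lambda>s. \<eta> *\<^sub>R gradient (\<lambda>z. u1 z (x2 s)) (x1 s)) has_integral (y1 t - y1 0)) {0..t} \<and>
      ((\<lambda>s. \<eta> *\<^sub>R gradient (\<lambda>z. u2 (x1 s) z) (x2 s)) has_integral (y2 t - y2 0)) {0..t} \<and>
      is_arg_max (\<lambda>x. x \<bullet> y1 t - h1 x) (\<lambda>x. x \<in> X1) (x1 t) \<and>
      is_arg_max (\<lambda>x. x \<bullet> y2 t - h2 x) (\<lambda>x. x \<in> X2) (x2 t))"

end

theory Submission
  imports Defs
begin

text \<open>The energy \<open>H = h1* (y1) + h2* (y2)\<close> does not increase along the dynamics. Since both conjugates
are non-negative, \<open>y1\<close> then stays in a level set of \<open>h1*\<close> that depends only on the initial values, and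
the integral of \<open>A x2\<close> is \<open>(y1 T - y1 0) / \<eta>\<close>.

The conjugates need not be differentiable, because the \<open>h\<close> are not assumed lower semicontinuous, so the
strategies can jump and the chain rule for \<open>H\<close> is not available. Instead, \<open>x t\<close> is a subgradient at
\<open>y t\<close>, so \<open>H t - H (t - h)\<close> is at most \<open>x t \<bullet> (y t - y (t - h))\<close>. By Lebesgue differentiation and
skew-symmetry of the payoffs this is \<open>o(h)\<close> for almost every \<open>t\<close>, which suffices for the Lipschitz
function \<open>H\<close>.\<close>

section \<open>Monotonicity from one-sided local conditions\<close>

text \<open>The points where \<open>\<phi>\<close> is at least \<open>\<phi> b\<close> form a closed
  set, so there is a least one. If it were not \<open>a\<close>, the step to the left from it would
  stay in the set and contradict minimality.\<close>

lemma le_if_left_locally_le: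
  fixes \<phi> :: "real \<Rightarrow> real"
  assumes "a \<le> b" and cont: "continuous_on {a..b} \<phi>"
    and left: "\<And>t. a < t \<Longrightarrow> t \<le> b \<Longrightarrow> \<exists>s. a \<le> s \<and> s < t \<and> \<phi> t \<le> \<phi> s"
  shows "\<phi> b \<le> \<phi> a"
proof -
  define S where "S = {a..b} \<inter> \<phi> -` {\<phi> b..}"
  have "closed S"
    unfolding S_def by (intro continuous_closed_preimage cont) auto
  moreover have "b \<in> S" and S: "S \<subseteq> {a..b}"
    using \<open>a \<le> b\<close> by (auto simp: S_def)
  ultimately have "Inf S \<in> S"
    by (intro closed_contains_Inf) (auto intro!: bdd_belowI[of _ a])
  show ?thesis
  proof (cases "Inf S = a")
    case True
    with \<open>Inf S \<in> S\<close> show ?thesis by (simp add: S_def)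
  next
    case False
    with \<open>Inf S \<in> S\<close> S have "a < Inf S" "Inf S \<le> b" by fastforce+
    then obtain s where s: "a \<le> s" "s < Inf S" "\<phi> (Inf S) \<le> \<phi> s"
      using left by blast
    with \<open>Inf S \<in> S\<close> have "s \<in> S" by (auto simp: S_def)
    then have "Inf S \<le> s"
      using S by (intro cInf_lower) (auto intro!: bdd_belowI[of _ a])
    with s show ?thesis by simp
  qed
qed

text \<open>The Lipschitz bound from above rules out growth concentrated on a null set, as in the
  Cantor function: on an open cover of \<open>N\<close> of measure below \<open>e\<close>,
  \<open>H\<close> gains at most \<open>K * e\<close>, and elsewhere it grows with slope at most
  \<open>e\<close>. Then \<open>e\<close> tends to 0.\<close>

lemma le_if_left_derivative_nonpos_ae:
  fixes H :: "real \<Rightarrow> real"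
  assumes "a \<le> b" and cont: "continuous_on {a..b} H"
    and lip: "\<And>s t. a \<le> s \<Longrightarrow> s \<le> t \<Longrightarrow> t \<le> b \<Longrightarrow> H t - H s \<le> L * (t - s)"
    and "negligible N"
    and left: "\<And>t e. a < t \<Longrightarrow> t \<le> b \<Longrightarrow> t \<notin> N \<Longrightarrow> 0 < e \<Longrightarrow>
      \<exists>d>0. \<forall>h. 0 < h \<and> h < d \<longrightarrow> H t - H (t - h) \<le> e * h"
  shows "H b \<le> H a"
proof -
  \<comment> \<open>A nonnegative constant is wanted so that \<open>K * \<mu> t\<close> below is
    nondecreasing in \<open>t\<close>.\<close>
  define K where "K = max L 0"
  have K: "H t - H s \<le> K * (t - s)" if "a \<le> s" "s \<le> t" "t \<le> b" for s t
  proof -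
    have "L * (t - s) \<le> K * (t - s)"
      using that by (intro mult_right_mono) (auto simp: K_def)
    with lip[OF that] show ?thesis by simp
  qed
  have "0 \<le> K" by (simp add: K_def)
  have approx: "H b - H a \<le> e * (b - a) + K * e" if "e > 0" for e
  proof -
    have N: "N \<in> lmeasurable" "measure lebesgue N = 0"
      using \<open>negligible N\<close> negligible_iff_measure by auto
    then obtain U where U: "open U" "N \<subseteq> U" and diff: "U - N \<in> lmeasurable"
      "emeasure lebesgue (U - N) < ennreal e"
      using sets_lebesgue_outer_open[of N e] \<open>e > 0\<close> by (auto simp: fmeasurable_def)
    have "U = (U - N) \<union> N" "(U - N) \<inter> N = {}" using U(2) by blast+
    then have "U \<in> lmeasurable" "measure lebesgue U = measure lebesgue (U - N)"
      using fmeasurable.Un[OF diff(1) N(1)] measure_Un3[OF diff(1) N(1)] N(2)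
      by (metis, metis measure_empty diff_zero add.right_neutral)
    moreover have "measure lebesgue (U - N) < e"
      using diff \<open>e > 0\<close> by (simp add: emeasure_eq_measure2 ennreal_less_iff)
    ultimately have U': "U \<in> lmeasurable" "measure lebesgue U < e" by simp_all
    define \<mu> where "\<mu> t = measure lebesgue (U \<inter> {a..t})" for t
    have meas: "U \<inter> {s..t} \<in> lmeasurable" "U \<inter> {s<..t} \<in> lmeasurable" for s t
      using U'(1) by (auto intro!: fmeasurable_Int_fmeasurable)
    have \<mu>_diff: "\<mu> t - \<mu> s = measure lebesgue (U \<inter> {s<..t})" if "a \<le> s" "s \<le> t" for s t
    proof -
      have "U \<inter> {a..t} = (U \<inter> {a..s}) \<union> (U \<inter> {s<..t})"
        using that by auto
      moreover have "(U \<inter> {a..s}) \<inter> (U \<inter> {s<..t}) = {}" by auto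
      moreover from this have "measure lebesgue ((U \<inter> {a..s}) \<union> (U \<inter> {s<..t})) =
          measure lebesgue (U \<inter> {a..s}) + measure lebesgue (U \<inter> {s<..t})"
        using measure_Un3[OF meas(1)[of a s] meas(2)[of s t]] by simp
      ultimately show ?thesis by (simp add: \<mu>_def)
    qed
    have \<mu>_bounds: "0 \<le> \<mu> t - \<mu> s" "\<mu> t - \<mu> s \<le> t - s" if "a \<le> s" "s \<le> t" for s t
    proof -
      have "measure lebesgue (U \<inter> {s<..t}) \<le> measure lebesgue {s..t}"
        using meas by (intro measure_mono_fmeasurable) auto
      then show "0 \<le> \<mu> t - \<mu> s" "\<mu> t - \<mu> s \<le> t - s"
        using \<mu>_diff[OF that] that by auto
    qed
    have "1-lipschitz_on {a..b} \<mu>"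
    proof (rule lipschitz_onI)
      fix s t assume "s \<in> {a..b}" "t \<in> {a..b}"
      then show "dist (\<mu> s) (\<mu> t) \<le> 1 * dist s t"
        using \<mu>_bounds[of s t] \<mu>_bounds[of t s] by (cases "s \<le> t") (auto simp: dist_real_def)
    qed simp
    then have "continuous_on {a..b} \<mu>"
      by (rule lipschitz_on_continuous_on)
    \<comment> \<open>On the open cover \<open>U\<close> of the exceptional set, \<open>\<mu>\<close> has slope 1, which absorbs the growth of \<open>H\<close>.\<close>
    define \<phi> where "\<phi> t = H t - e * t - K * \<mu> t" for t
    have "\<phi> b \<le> \<phi> a"
    proof (rule le_if_left_locally_le[OF \<open>a \<le> b\<close>])
      show "continuous_on {a..b} \<phi>"
        unfolding \<phi>_def by (intro continuous_intros cont \<open>continuous_on {a..b} \<mu>\<close>)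
      fix t assume t: "a < t" "t \<le> b"
      show "\<exists>s. a \<le> s \<and> s < t \<and> \<phi> t \<le> \<phi> s"
      proof (cases "t \<in> U")
        case True
        then obtain r where r: "r > 0" "ball t r \<subseteq> U"
          using U(1) open_contains_ball by blast
        define s where "s = max a (t - r / 2)"
        have s: "a \<le> s" "s < t" "{s<..t} \<subseteq> U"
          using t r by (auto simp: s_def dist_real_def subset_iff)
        then have "\<mu> t - \<mu> s = t - s"
          using \<mu>_diff[of s t] by (simp add: inf.absorb2)
        then have "K * \<mu> t - K * \<mu> s = K * (t - s)"
          by (simp flip: right_diff_distrib)
        moreover have "0 \<le> e * (t - s)" using s \<open>e > 0\<close> by simp
        ultimately have "\<phi> t \<le> \<phi> s"
          using K[of s t] s t by (simp add: \<phi>_def algebra_simps)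
        with s show ?thesis by blast
      next
        \<comment> \<open>Outside \<open>U\<close> the left derivative bound controls
          \<open>H\<close> with slope \<open>e\<close>; since \<open>\<mu>\<close> is nondecreasing,
          subtracting \<open>K * \<mu>\<close> only helps.\<close>
        case False
        with U(2) have "t \<notin> N" by blast
        from left[OF t this \<open>e > 0\<close>] obtain d where
          d: "d > 0" "\<And>h. 0 < h \<Longrightarrow> h < d \<Longrightarrow> H t - H (t - h) \<le> e * h" by blast
        define h where "h = min (d / 2) (t - a)"
        have h: "0 < h" "h < d" "a \<le> t - h"
          using d(1) t by (auto simp: h_def)
        have "K * \<mu> (t - h) \<le> K * \<mu> t"
          using \<mu>_bounds(1)[of "t - h" t] h \<open>0 \<le> K\<close> by (intro mult_left_mono) auto
        then have "\<phi> t \<le> \<phi> (t - h)"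
          using d(2)[OF h(1,2)] by (simp add: \<phi>_def algebra_simps)
        with h show ?thesis by (intro exI[of _ "t - h"]) auto
      qed
    qed
    moreover have "K * (\<mu> b - \<mu> a) \<le> K * e"
    proof -
      have "\<mu> b \<le> measure lebesgue U"
        unfolding \<mu>_def using U'(1) meas by (intro measure_mono_fmeasurable) auto
      moreover have "0 \<le> \<mu> a" by (simp add: \<mu>_def)
      ultimately show ?thesis
        using U'(2) \<open>0 \<le> K\<close> by (intro mult_left_mono) auto
    qed
    ultimately show ?thesis by (simp add: \<phi>_def algebra_simps)
  qed
  have "((\<lambda>e. e * (b - a) + K * e) \<longlongrightarrow> 0 * (b - a) + K * 0) (at_right 0)"
    by (intro tendsto_intros)
  moreover have "eventually (\<lambda>e. H b - H a \<le> e * (b - a) + K * e) (at_right (0::real))"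
    using approx by (auto simp: eventually_at_right_less intro: eventually_at_rightI[of 0 1])
  ultimately have "H b - H a \<le> 0 * (b - a) + K * 0"
    by (rule tendsto_lowerbound) simp
  then show ?thesis by simp
qed

section \<open>Lebesgue differentiation of an indefinite integral from the left\<close>

text \<open>\<open>integrable_ccontinuous_explicit\<close> averages over intervals to the right of a
  point. Reflecting the line in 0 turns these into the intervals \<open>{t - h..t}\<close>.\<close>

lemma integral_left_derivative_ae:
  fixes f :: "real \<Rightarrow> 'a::euclidean_space"
  assumes f: "\<And>t. a \<le> t \<Longrightarrow> t \<le> b \<Longrightarrow> (f has_integral F t - F a) {a..t}"
  obtains N where "negligible N"
    "\<And>t e. a < t \<Longrightarrow> t \<le> b \<Longrightarrow> t \<notin> N \<Longrightarrow> 0 < e \<Longrightarrow>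
      \<exists>d>0. \<forall>h. 0 < h \<and> h < d \<longrightarrow> norm (F t - F (t - h) - h *\<^sub>R f t) \<le> e * h"
proof (cases "a \<le> b")
  case False
  then show ?thesis by (intro that[of "{}"]) auto
next
  case True
  \<comment> \<open>Extension by 0 makes the reflected function integrable on every box, as the
    differentiation theorem demands.\<close>
  define g where "g x = (if x \<in> {-b..-a} then f (- x) else 0)" for x
  have "f integrable_on {a..b}" using f[of b] True by blast
  then have "(\<lambda>x. f (- x)) integrable_on {-b..-a}"
    by (simp add: integrable_on_def)
  then have "g integrable_on UNIV"
    unfolding g_def Henstock_Kurzweil_Integration.integrable_restrict_UNIV .
  then have "g integrable_on cbox u v" for u v
    by (rule integrable_on_subcbox) auto
  then obtain M where M: "negligible M"
    "\<And>x e. \<lbrakk>x \<notin> M; 0 < e\<rbrakk> \<Longrightarrow> \<exists>d>0. \<forall>h. 0 < h \<and> h < d \<longrightarrow>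
      norm (integral (cbox x (x + h *\<^sub>R One)) g /\<^sub>R h ^ DIM(real) - g x) < e"
    using integrable_ccontinuous_explicit[of g] by blast
  show ?thesis
  proof (rule that[of "uminus ` M"])
    show "negligible (uminus ` M)"
      using M(1) by (intro negligible_differentiable_image_negligible) (auto intro!: derivative_intros)
    fix t e :: real assume t: "a < t" "t \<le> b" "t \<notin> uminus ` M" and "0 < e"
    then have "- t \<notin> M" by force
    from M(2)[OF this \<open>0 < e\<close>] obtain d where d: "d > 0" "\<And>h. 0 < h \<Longrightarrow> h < d \<Longrightarrow>
        norm (integral {-t..-t + h} g /\<^sub>R h - g (- t)) < e" by auto
    \<comment> \<open>The bound \<open>h < t - a\<close> keeps \<open>{-t..-t + h}\<close> inside
      \<open>{-b..-a}\<close>, where \<open>g\<close> is the reflection of \<open>f\<close>.\<close>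
    have "norm (F t - F (t - h) - h *\<^sub>R f t) \<le> e * h"
      if h: "0 < h" "h < min d (t - a)" for h
    proof -
      have "(f has_integral F t - F (t - h)) {t - h..t}"
      proof -
        have "f integrable_on {a..t}" "a \<le> t - h" "t - h \<le> t" using f[of t] t h by auto
        then have "integral {a..t - h} f + integral {t - h..t} f = integral {a..t} f"
          "f integrable_on {t - h..t}"
          by (auto intro: Henstock_Kurzweil_Integration.integral_combine integrable_on_subinterval)
        moreover have "integral {a..t - h} f = F (t - h) - F a" "integral {a..t} f = F t - F a"
          using f[of "t - h"] f[of t] t h by (auto intro!: integral_unique)
        ultimately have "integral {t - h..t} f = F t - F (t - h)"
          by (metis add_diff_cancel_left' diff_diff_eq2 diff_add_cancel)
        with \<open>f integrable_on {t - h..t}\<close> show ?thesis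
          by (metis integrable_integral)
      qed
      then have "((\<lambda>x. f (- x)) has_integral F t - F (t - h)) {-t..-t + h}"
        using has_integral_reflect_real[of f "F t - F (t - h)" t "t - h"] by simp
      then have "(g has_integral F t - F (t - h)) {-t..-t + h}"
        using t h by (auto simp: g_def intro: has_integral_eq[rotated])
      then have "integral {-t..-t + h} g = F t - F (t - h)"
        by (rule integral_unique)
      moreover have "g (- t) = f t" using t by (simp add: g_def)
      ultimately have "norm ((F t - F (t - h)) /\<^sub>R h - f t) < e"
        using d(2)[of h] h by simp
      then have "h * norm ((F t - F (t - h)) /\<^sub>R h - f t) \<le> h * e"
        using h by (intro mult_left_mono) auto
      moreover have "h * norm ((F t - F (t - h)) /\<^sub>R h - f t) =
          norm (h *\<^sub>R ((F t - F (t - h)) /\<^sub>R h - f t))"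
        using h by simp
      moreover have "h *\<^sub>R ((F t - F (t - h)) /\<^sub>R h - f t) = F t - F (t - h) - h *\<^sub>R f t"
        using h by (simp add: scaleR_diff_right)
      ultimately show ?thesis by (simp add: mult.commute)
    qed
    then show "\<exists>d>0. \<forall>h. 0 < h \<and> h < d \<longrightarrow> norm (F t - F (t - h) - h *\<^sub>R f t) \<le> e * h"
      using d(1) t by (intro exI[of _ "min d (t - a)"]) auto
  qed
qed

section \<open>Flows driven by a skew image of a subgradient\<close>

text \<open>Testing the subgradient inequality at the unit step \<open>w = z + sgn x\<close> gives
  \<open>norm x \<le> f (z + sgn x) - f z\<close>, and \<open>f\<close> is bounded on a ball that
  contains \<open>S\<close> and all unit steps from it.\<close>

lemma subgradient_bounded:
  fixes f :: "'a::euclidean_space \<Rightarrow> real"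
  assumes cont: "continuous_on UNIV f" and "bounded S"
  obtains M where "0 \<le> M"
    "\<And>x z. z \<in> S \<Longrightarrow> (\<And>w. f z + x \<bullet> (w - z) \<le> f w) \<Longrightarrow> norm x \<le> M"
proof -
  obtain R where R: "\<And>z. z \<in> S \<Longrightarrow> norm z \<le> R"
    using \<open>bounded S\<close> bounded_iff by blast
  have "compact (f ` cball 0 (R + 1))"
    by (intro compact_continuous_image continuous_on_subset[OF cont]) auto
  then obtain B where B: "\<And>z. norm z \<le> R + 1 \<Longrightarrow> \<bar>f z\<bar> \<le> B"
    using compact_imp_bounded bounded_iff by (metis image_eqI mem_cball_0 real_norm_def)
  have bound: "norm x \<le> 2 * \<bar>B\<bar>" if z: "z \<in> S" and x: "\<And>w. f z + x \<bullet> (w - z) \<le> f w" for x z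
  proof (cases "x = 0")
    case False
    have "norm (z + sgn x) \<le> norm z + norm (sgn x)" by (rule norm_triangle_ineq)
    then have "norm (z + sgn x) \<le> R + 1" using R[OF z] by (simp add: norm_sgn split: if_splits)
    then have "\<bar>f (z + sgn x)\<bar> \<le> B" "\<bar>f z\<bar> \<le> B" using B R[OF z] by force+
    moreover have "x \<bullet> sgn x = norm x"
      using False by (simp add: sgn_div_norm dot_square_norm power2_eq_square)
    ultimately show ?thesis using x[of "z + sgn x"] by simp
  qed simp
  \<comment> \<open>The absolute value secures \<open>0 \<le> M\<close> also for empty
    \<open>S\<close>, when \<open>B\<close> may be negative.\<close>
  show ?thesis by (rule that[of "2 * \<bar>B\<bar>"]) (use bound in auto)
qed

text \<open>The subgradient at the later time \<open>t\<close>, tested at the earlier point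
  \<open>z (t - h)\<close>, bounds the increment of \<open>f\<close> from above; this is why left
  derivatives are used. The first-order term \<open>h * (x t \<bullet> J (x t))\<close> vanishes by
  skewness.\<close>

lemma skew_subgradient_flow_le:
  fixes f :: "'a::euclidean_space \<Rightarrow> real" and z x :: "real \<Rightarrow> 'a"
  assumes cont: "continuous_on UNIV f" and "linear J" and skew: "\<And>v. v \<bullet> J v = 0"
    and flow: "\<And>t. 0 \<le> t \<Longrightarrow> ((\<lambda>s. J (x s)) has_integral z t - z 0) {0..t}"
    and sub: "\<And>t w. 0 \<le> t \<Longrightarrow> f (z t) + x t \<bullet> (w - z t) \<le> f w"
    and "0 \<le> T"
  shows "f (z T) \<le> f (z 0)"
proof -
  have "continuous_on {0..T} (\<lambda>t. z 0 + integral {0..t} (\<lambda>s. J (x s)))"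
    using flow[OF \<open>0 \<le> T\<close>] by (intro continuous_intros indefinite_integral_continuous_1) blast
  moreover have "z 0 + integral {0..t} (\<lambda>s. J (x s)) = z t" if "0 \<le> t" for t
    using integral_unique[OF flow[OF that]] by simp
  ultimately have contz: "continuous_on {0..T} z"
    by (subst (asm) continuous_on_cong[OF refl]) auto
  \<comment> \<open>The trajectory stays in a compact set up to time \<open>T\<close>, so the
    subgradients \<open>x t\<close> are bounded there. This makes \<open>z\<close>, and with it
    \<open>f\<close> along \<open>z\<close>, Lipschitz.\<close>
  then have "bounded (z ` {0..T})"
    by (intro compact_imp_bounded compact_continuous_image) auto
  then obtain M where M: "0 \<le> M"
    "\<And>x y. y \<in> z ` {0..T} \<Longrightarrow> (\<And>w. f y + x \<bullet> (w - y) \<le> f w) \<Longrightarrow> norm x \<le> M"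
    using subgradient_bounded[OF cont] by metis
  have x: "norm (x t) \<le> M" if "t \<in> {0..T}" for t
    using that sub by (intro M(2)[of "z t"]) auto
  obtain K where K: "0 < K" "\<And>v. norm (J v) \<le> norm v * K"
    using \<open>linear J\<close> linear_conv_bounded_linear bounded_linear.pos_bounded by metis
  have Jx: "norm (J (x t)) \<le> M * K" if "t \<in> {0..T}" for t
    using K(2)[of "x t"] mult_right_mono[OF x[OF that], of K] K(1) by linarith
  have z_lip: "norm (z t - z s) \<le> M * K * (t - s)" if st: "0 \<le> s" "s \<le> t" "t \<le> T" for s t
  proof -
    let ?g = "\<lambda>s. J (x s)"
    have "?g integrable_on {0..t}" using flow[of t] st by auto
    then have int: "?g integrable_on {s..t}"
      "integral {0..s} ?g + integral {s..t} ?g = integral {0..t} ?g"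
      using st by (auto intro: Henstock_Kurzweil_Integration.integral_combine integrable_on_subinterval)
    then have "integral {s..t} ?g = z t - z s"
      using integral_unique[OF flow[of s]] integral_unique[OF flow[of t]] st
      by (simp add: algebra_simps)
    with int(1) have "(?g has_integral z t - z s) (cbox s t)"
      by (metis integrable_integral interval_cbox)
    then have "norm (z t - z s) \<le> M * K * measure lborel (cbox s t)"
      using Jx st M(1) K(1) by (intro has_integral_bound[of _ ?g]) auto
    then show ?thesis using st by simp
  qed
  have upper: "f (z t) - f (z s) \<le> x t \<bullet> (z t - z s)" if "0 \<le> t" for s t
    using sub[OF that, of "z s"] by (simp add: inner_diff_right)
  obtain N where N: "negligible N"
    "\<And>t e. 0 < t \<Longrightarrow> t \<le> T \<Longrightarrow> t \<notin> N \<Longrightarrow> 0 < e \<Longrightarrow>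
      \<exists>d>0. \<forall>h. 0 < h \<and> h < d \<longrightarrow> norm (z t - z (t - h) - h *\<^sub>R J (x t)) \<le> e * h"
    using integral_left_derivative_ae[of 0 T "\<lambda>s. J (x s)" z] flow by blast
  show ?thesis
  \<comment> \<open>In the Lipschitz constant, \<open>M\<close> bounds the subgradients and
    \<open>M * K\<close> the speed of \<open>z\<close>.\<close>
  proof (rule le_if_left_derivative_nonpos_ae[OF \<open>0 \<le> T\<close> _ _ N(1), of "\<lambda>t. f (z t)" "M * (M * K)"])
    show "continuous_on {0..T} (\<lambda>t. f (z t))"
      using continuous_on_compose2[OF cont contz] by simp
  next
    fix s t assume st: "0 \<le> s" "s \<le> t" "t \<le> T"
    have "x t \<bullet> (z t - z s) \<le> norm (x t) * norm (z t - z s)"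
      by (rule norm_cauchy_schwarz)
    also have "\<dots> \<le> M * (M * K * (t - s))"
      using x[of t] z_lip[OF st] st M(1) by (intro mult_mono) auto
    finally show "f (z t) - f (z s) \<le> M * (M * K) * (t - s)"
      using upper[of t s] st by (simp add: mult.assoc)
  next
    fix t e :: real assume t: "0 < t" "t \<le> T" "t \<notin> N" "0 < e"
    \<comment> \<open>The remainder gets multiplied by \<open>norm (x t) \<le> M\<close>;
      \<open>M + 1\<close> avoids division by zero.\<close>
    have "0 < e / (M + 1)" using t M(1) by simp
    from N(2)[OF t(1-3) this] obtain d where d: "d > 0"
      "\<And>h. 0 < h \<Longrightarrow> h < d \<Longrightarrow> norm (z t - z (t - h) - h *\<^sub>R J (x t)) \<le> e / (M + 1) * h" by blast
    have "f (z t) - f (z (t - h)) \<le> e * h" if h: "0 < h" "h < d" for h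
    proof -
      let ?r = "z t - z (t - h) - h *\<^sub>R J (x t)"
      have "x t \<bullet> (z t - z (t - h)) = x t \<bullet> ?r"
        using skew[of "x t"] by (simp add: inner_diff_right)
      also have "\<dots> \<le> norm (x t) * norm ?r"
        by (rule norm_cauchy_schwarz)
      also have "\<dots> \<le> (M + 1) * (e / (M + 1) * h)"
        using x[of t] t M(1) d(2)[OF h] by (intro mult_mono) auto
      also have "\<dots> = e * h" using M(1) by simp
      finally show ?thesis using upper[of t "t - h"] t by simp
    qed
    with d(1) show "\<exists>d>0. \<forall>h. 0 < h \<and> h < d \<longrightarrow> f (z t) - f (z (t - h)) \<le> e * h" by blast
  qed
qed

section \<open>Convex conjugates: subgradients, convexity, continuity\<close>

lemma convex_conjugate_eq:
  assumes "is_arg_max (\<lambda>x. x \<bullet> y - h x) (\<lambda>x. x \<in> X) x"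
  shows "convex_conjugate X h y = x \<bullet> y - h x"
  unfolding convex_conjugate_def
  using assms by (intro cSup_eq_maximum) (auto simp: is_arg_max_linorder)

lemma convex_conjugate_ge:
  assumes "conjugate_attained X h" and "x \<in> X"
  shows "x \<bullet> y - h x \<le> convex_conjugate X h y"
proof -
  obtain x' where x': "is_arg_max (\<lambda>x. x \<bullet> y - h x) (\<lambda>x. x \<in> X) x'"
    using assms(1) by (auto simp: conjugate_attained_def)
  with \<open>x \<in> X\<close> show ?thesis
    unfolding convex_conjugate_eq[OF x'] by (simp add: is_arg_max_linorder)
qed

text \<open>The maximiser at \<open>y\<close> is still a candidate in the maximum at
  \<open>w\<close>.\<close>

lemma convex_conjugate_subgradient:
  assumes "conjugate_attained X h"
    and x: "is_arg_max (\<lambda>x. x \<bullet> y - h x) (\<lambda>x. x \<in> X) x"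
  shows "convex_conjugate X h y + x \<bullet> (w - y) \<le> convex_conjugate X h w"
proof -
  have "x \<in> X" using x by (simp add: is_arg_max_def)
  from convex_conjugate_ge[OF assms(1) this, of w] show ?thesis
    unfolding convex_conjugate_eq[OF x] by (simp add: inner_diff_right)
qed

text \<open>A maximum of affine functions is convex: the maximiser at the intermediate point is a
  candidate at both ends.\<close>

lemma convex_on_convex_conjugate:
  assumes "conjugate_attained X h"
  shows "convex_on UNIV (convex_conjugate X h)"
proof (rule convex_onI)
  fix t :: real and y w :: 'a
  assume t: "0 < t" "t < 1"
  let ?v = "(1 - t) *\<^sub>R y + t *\<^sub>R w"
  obtain x where x: "is_arg_max (\<lambda>x. x \<bullet> ?v - h x) (\<lambda>x. x \<in> X) x"
    using assms by (auto simp: conjugate_attained_def)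
  then have "x \<in> X" by (simp add: is_arg_max_def)
  then have "(1 - t) * (x \<bullet> y - h x) \<le> (1 - t) * convex_conjugate X h y"
    "t * (x \<bullet> w - h x) \<le> t * convex_conjugate X h w"
    using t convex_conjugate_ge[OF assms] by (auto intro!: mult_left_mono)
  then show "convex_conjugate X h ?v \<le> (1 - t) * convex_conjugate X h y + t * convex_conjugate X h w"
    unfolding convex_conjugate_eq[OF x] by (simp add: inner_add_right algebra_simps)
qed simp

text \<open>Attainment for every \<open>y\<close> makes the conjugate a finite convex function on
  the whole space, and in finite dimension such functions are continuous.\<close>

lemma continuous_on_convex_conjugate:
  fixes X :: "'a::euclidean_space set"
  assumes "conjugate_attained X h"
  shows "continuous_on S (convex_conjugate X h)"
  using convex_on_continuous[OF open_UNIV convex_on_convex_conjugate[OF assms]]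
  by (rule continuous_on_subset) simp

section \<open>The game dynamics as one flow on the product space\<close>

lemma has_integral_Pair:
  fixes f :: "'a::euclidean_space \<Rightarrow> 'b::real_normed_vector" and g :: "'a \<Rightarrow> 'c::real_normed_vector"
  assumes "(f has_integral i) S" and "(g has_integral j) S"
  shows "((\<lambda>x. (f x, g x)) has_integral (i, j)) S"
proof -
  have "((\<lambda>x. (x, 0::'c)) \<circ> f has_integral (i, 0)) S" "((\<lambda>x. (0::'b, x)) \<circ> g has_integral (0, j)) S"
    using assms by (auto intro!: has_integral_linear bounded_linear_Pair bounded_linear_ident)
  from has_integral_add[OF this] show ?thesis by (simp add: o_def)
qed

lemma ftrl_energy_le:
  fixes A :: "real^'n^'m"
  assumes att: "conjugate_attained X1 h1" "conjugate_attained X2 h2"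
    and ftrl: "ftrl_dynamics X1 X2 h1 h2 (bilinear_payoff A) (\<lambda>a b. - bilinear_payoff A a b)
      \<eta> y1 y2 x1 x2"
    and "0 \<le> T"
  shows "convex_conjugate X1 h1 (y1 T) + convex_conjugate X2 h2 (y2 T) \<le>
    convex_conjugate X1 h1 (y1 0) + convex_conjugate X2 h2 (y2 0)"
proof -
  define f where "f w = convex_conjugate X1 h1 (fst w) + convex_conjugate X2 h2 (snd w)"
    for w :: "(real^'m) \<times> (real^'n)"
  \<comment> \<open>Up to the factor \<open>\<eta>\<close>, the block matrix with rows
    \<open>(0, A)\<close> and \<open>(- transpose A, 0)\<close>; its skewness is the zero-sum
    property.\<close>
  define J where "J v = (\<eta> *\<^sub>R (A *v snd v), \<eta> *\<^sub>R - (transpose A *v fst v))"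
    for v :: "(real^'m) \<times> (real^'n)"
  have "f (y1 T, y2 T) \<le> f (y1 0, y2 0)"
  proof (rule skew_subgradient_flow_le[of f J "\<lambda>t. (x1 t, x2 t)" "\<lambda>t. (y1 t, y2 t)"])
    show "continuous_on UNIV f"
      unfolding f_def
      by (intro continuous_intros continuous_on_compose2[OF continuous_on_convex_conjugate[of _ _ UNIV]] att)
        auto
    show "linear J"
      by (rule linearI) (auto simp: J_def matrix_vector_right_distrib matrix_vector_mult_scaleR
        algebra_simps simp del: transpose_matrix_vector)
    show "v \<bullet> J v = 0" for v
      using dot_lmul_matrix[of "fst v" A "snd v"] by (simp add: J_def inner_prod_def inner_commute)
    show "((\<lambda>s. J (x1 s, x2 s)) has_integral (y1 t, y2 t) - (y1 0, y2 0)) {0..t}" if "0 \<le> t" for t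
      using ftrl that
      by (auto simp: ftrl_dynamics_def gradient_bilinear_payoff_left gradient_bilinear_payoff_right
        J_def intro!: has_integral_Pair)
    show "f (y1 t, y2 t) + (x1 t, x2 t) \<bullet> (w - (y1 t, y2 t)) \<le> f w" if "0 \<le> t" for t w
      using convex_conjugate_subgradient[OF att(1), of "y1 t" "x1 t" "fst w"]
        convex_conjugate_subgradient[OF att(2), of "y2 t" "x2 t" "snd w"] ftrl that
      by (auto simp: ftrl_dynamics_def f_def inner_prod_def)
  qed (fact \<open>0 \<le> T\<close>)
  then show ?thesis by (simp add: f_def)
qed

section \<open>The bound on the time average\<close>

theorem lemma1:
  fixes X1 :: "(real^'m) set" and X2 :: "(real^'n) set"
    and A :: "real^'n^'m"
    and h1 :: "real^'m \<Rightarrow> real" and h2 :: "real^'n \<Rightarrow> real"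
    and y1_init :: "real^'m" and y2_init :: "real^'n"
  assumes "X1 \<noteq> {}" and "convex X1" and "X2 \<noteq> {}" and "convex X2"
    and "\<exists>xs1 xs2. nash_equilibrium X1 X2 (bilinear_payoff A) xs1 xs2"
    and "strictly_convex_on X1 h1" and "strictly_convex_on X2 h2"
    and "conjugate_attained X1 h1" and "conjugate_attained X2 h2"
    and "\<forall>y. 0 \<le> convex_conjugate X1 h1 y" and "\<forall>y. 0 \<le> convex_conjugate X2 h2 y"
    and "compact_level_sets (convex_conjugate X1 h1)"
    and "compact_level_sets (convex_conjugate X2 h2)"
  shows "\<exists>C. \<forall>\<eta>>0. \<forall>y1 y2 x1 x2.
    ftrl_dynamics X1 X2 h1 h2 (bilinear_payoff A) (\<lambda>a b. - bilinear_payoff A a b) \<eta> y1 y2 x1 x2 \<and>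
    y1 0 = y1_init \<and> y2 0 = y2_init \<longrightarrow>
    (\<forall>T>0. norm ((1 / T) *\<^sub>R integral {0..T} (\<lambda>t. A *v x2 t)) \<le> C / (\<eta> * T))"
proof -
  note att = assms(8,9) and nonneg = assms(10,11)
  \<comment> \<open>The initial energy depends neither on \<open>\<eta>\<close> nor on
    \<open>T\<close>, hence neither does the radius \<open>B\<close> of its level set.\<close>
  define E where "E = convex_conjugate X1 h1 y1_init + convex_conjugate X2 h2 y2_init"
  have "bounded {y. convex_conjugate X1 h1 y \<le> E}"
    using assms(12) by (simp add: compact_level_sets_def compact_imp_bounded)
  then obtain B where B: "\<And>y. convex_conjugate X1 h1 y \<le> E \<Longrightarrow> norm y \<le> B"
    by (auto simp: bounded_iff)
  show ?thesis
  proof (intro exI[of _ "B + norm y1_init"] allI impI, elim conjE)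
    fix \<eta> T :: real and y1 y2 x1 x2
    assume "0 < \<eta>" "0 < T" and init: "y1 0 = y1_init" "y2 0 = y2_init"
      and ftrl: "ftrl_dynamics X1 X2 h1 h2 (bilinear_payoff A) (\<lambda>a b. - bilinear_payoff A a b)
        \<eta> y1 y2 x1 x2"
    have "convex_conjugate X1 h1 (y1 T) + convex_conjugate X2 h2 (y2 T) \<le> E"
      using ftrl_energy_le[OF att ftrl, of T] \<open>0 < T\<close> by (simp add: E_def init)
    \<comment> \<open>Dropping this nonnegative term leaves \<open>E\<close> as a bound for the
      first conjugate alone, which places \<open>y1 T\<close> in the level set.\<close>
    moreover have "0 \<le> convex_conjugate X2 h2 (y2 T)"
      using nonneg by blast
    ultimately have "norm (y1 T) \<le> B" by (intro B) simp
    then have le: "norm (y1 T - y1 0) \<le> B + norm y1_init"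
      using norm_triangle_ineq4[of "y1 T" "y1 0"] init by simp
    \<comment> \<open>The payoff gradient of player 1 is \<open>A *v x2\<close>, so its integral is
      the bounded displacement of \<open>y1\<close> divided by \<open>\<eta>\<close>.\<close>
    have "((\<lambda>s. \<eta> *\<^sub>R (A *v x2 s)) has_integral y1 T - y1 0) {0..T}"
      using ftrl \<open>0 < T\<close> by (auto simp: ftrl_dynamics_def gradient_bilinear_payoff_left)
    from has_integral_cmul[OF this, of "inverse \<eta>"]
    have "integral {0..T} (\<lambda>t. A *v x2 t) = (y1 T - y1 0) /\<^sub>R \<eta>"
      using \<open>0 < \<eta>\<close> by (intro integral_unique) simp
    then have "norm ((1 / T) *\<^sub>R integral {0..T} (\<lambda>t. A *v x2 t)) = norm (y1 T - y1 0) / (\<eta> * T)"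
      using \<open>0 < \<eta>\<close> \<open>0 < T\<close> by (simp add: divide_inverse)
    also have "\<dots> \<le> (B + norm y1_init) / (\<eta> * T)"
      using le \<open>0 < \<eta>\<close> \<open>0 < T\<close> by (intro divide_right_mono) auto
    finally show "norm ((1 / T) *\<^sub>R integral {0..T} (\<lambda>t. A *v x2 t)) \<le> (B + norm y1_init) / (\<eta> * T)" .
  qed
qed

end
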